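(* Let $\mathcal{D}$ be a distributive lattice, and let $L_{\mathcal{D}}$ (resp. $X_{\mathcal{D}}$) be its associated Stone locale (resp. Stone space). Then the following conditions are equivalent: (i) $L_{\mathcal{D}}$ (equivalently, $X_{\mathcal{D}}$) is extremally disconnected; (ii) for every ideal $I$ of $\mathcal{D}$ there exists a finite covering $1=\bigvee_{k\in K}a_k$ of $1$ such that each $a_k$ either belongs to $\neg I$ (i.e. for any non-zero element $b\le a_k$, $b\notin I$) or to $\neg\neg I$ (i.e. for any non-zero element $b\le a_k$ there exists a non-zero element $c\in I$ such that $c\le b$); (iii) for any collection $\{a_i\mid i\in I\}$ of non-zero elements of $\mathcal{D}$ there exists a finite family $\{b_j\mid j\in J\}$ of non-zero elements of $\mathcal{D}$ such that $1=\bigvee_{j\in J}b_j$ and for each $j\in J$ either $b_j\wedge a_i=0$ for all $i\in I$ or for every non-zero element $x\le b_j$ there exists $i\in I$ such that $x\wedge a_i\neq0$; (iv) for any ideal $I$ of $\mathcal{D}$ with the property that every element $a\in\mathcal{D}$ such that for any non-zero $b\le a$ there exists a non-zero $c\in I$ with $c\le b$ belongs to $I$, there exists a complemented element $x\in\mathcal{D}$ such that $I=\{d\mid d\le x\}$; in fact, in this case the lattice of complemented elements of $\mathcal{D}$ is isomorphic, via the map sending a complemented element to the principal ideal it generates, to the frame of ideals $I$ such that $\neg\neg I=I$.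
   Context: Distributive lattices have $0$ and $1$. The Stone locale $L_{\mathcal{D}}$ is the locale whose frame is the set of ideals of $\mathcal{D}$ (lower sets containing $0$ and closed under binary joins) ordered by inclusion; $\neg$ denotes the Heyting pseudocomplement in this frame. The Stone space $X_{\mathcal{D}}$ is the set of prime filters of $\mathcal{D}$ with the topology having as basis the sets $\{F\mid d\in F\}$, $d\in\mathcal{D}$ (the axiom of choice is assumed for the identification of its frame of open sets with $L_{\mathcal{D}}$). A locale is extremally disconnected if $\neg a\vee\neg\neg a=1$ for every element $a$; a space is extremally disconnected if the closure of every open set is open. *)

theory Defs
  imports "HOL-Analysis.Analysis"
begin

class frame = complete_lattice +
  assumes inf_Sup_frame: "inf a (Sup B) = (SUP b\<in>B. inf a b)"

text \<open>
  The Heyting pseudocomplement, as the join of all elements disjoint from \<open>a\<close>; by the frame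
  law it is the largest of them (lemma \<open>le_pcompl_iff\<close>).
\<close>

definition pcompl :: "'a::frame \<Rightarrow> 'a" where
  "pcompl a = Sup {b. inf b a = bot}"

lemma le_pcompl_iff: "b \<le> pcompl a \<longleftrightarrow> inf b a = bot" for a b :: "'a::frame"
proof
  assume "b \<le> pcompl a"
  have "inf a (pcompl a) = (SUP c\<in>{c. inf c a = bot}. inf a c)"
    by (simp add: pcompl_def inf_Sup_frame)
  also have "\<dots> \<le> bot"
    by (rule SUP_least) (simp add: inf.commute)
  finally have "inf a (pcompl a) = bot"
    by (simp add: bot_unique)
  moreover have "inf b a \<le> inf a (pcompl a)"
    using \<open>b \<le> pcompl a\<close> by (simp add: le_infI1)
  ultimately show "inf b a = bot"
    by (simp add: bot_unique)
qed (simp add: pcompl_def Sup_upper)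

lemma pcompl_antimono: "a \<le> b \<Longrightarrow> pcompl b \<le> pcompl a" for a b :: "'a::frame"
  by (metis bot.extremum_uniqueI inf_mono le_pcompl_iff order_refl)

lemma le_pcompl_pcompl: "a \<le> pcompl (pcompl a)" for a :: "'a::frame"
  by (metis inf.commute le_pcompl_iff order_refl)

lemma pcompl_pcompl_pcompl: "pcompl (pcompl (pcompl a)) = pcompl a" for a :: "'a::frame"
  by (simp add: antisym le_pcompl_pcompl pcompl_antimono)

text \<open>A locale is given by its frame, here a type of class frame passed as a type argument.\<close>

definition extremally_disconnected_locale :: "'a::frame itself \<Rightarrow> bool" where
  "extremally_disconnected_locale _ \<longleftrightarrow> (\<forall>a::'a. sup (pcompl a) (pcompl (pcompl a)) = top)"

definition extremally_disconnected_space :: "'a topology \<Rightarrow> bool" where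
  "extremally_disconnected_space X \<longleftrightarrow> (\<forall>U. openin X U \<longrightarrow> openin X (X closure_of U))"

typedef (overloaded) 'a regular_elt = "{a :: 'a::frame. pcompl (pcompl a) = a}"
  morphisms regular_val Abs_regular_elt
  by (rule exI[of _ "pcompl bot"]) (simp add: pcompl_pcompl_pcompl)

setup_lifting type_definition_regular_elt

instantiation regular_elt :: (frame) frame
begin

lift_definition less_eq_regular_elt :: "'a regular_elt \<Rightarrow> 'a regular_elt \<Rightarrow> bool" is "(\<le>)" .

lift_definition less_regular_elt :: "'a regular_elt \<Rightarrow> 'a regular_elt \<Rightarrow> bool" is "(<)" .

lift_definition bot_regular_elt :: "'a regular_elt" is bot
proof -
  have "top \<le> pcompl (bot :: 'a)"
    by (simp add: le_pcompl_iff)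
  then have "inf (pcompl (pcompl bot)) top = (bot :: 'a)"
    by (metis le_pcompl_iff order_refl top.extremum_uniqueI)
  then show "pcompl (pcompl bot) = (bot :: 'a)"
    by simp
qed

lift_definition top_regular_elt :: "'a regular_elt" is top
  by (simp add: le_pcompl_pcompl top.extremum_uniqueI)

lift_definition inf_regular_elt :: "'a regular_elt \<Rightarrow> 'a regular_elt \<Rightarrow> 'a regular_elt" is inf
proof -
  fix a b :: 'a
  assume "pcompl (pcompl a) = a" "pcompl (pcompl b) = b"
  then have "pcompl (pcompl (inf a b)) \<le> inf a b"
    by (metis inf_le1 inf_le2 le_inf_iff pcompl_antimono)
  then show "pcompl (pcompl (inf a b)) = inf a b"
    by (simp add: antisym le_pcompl_pcompl)
qed

text \<open>
  The order and the meets of regular elements are those of the ambient frame; joins have to be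
  closed up under double negation.
\<close>

lift_definition sup_regular_elt :: "'a regular_elt \<Rightarrow> 'a regular_elt \<Rightarrow> 'a regular_elt"
  is "\<lambda>a b. pcompl (pcompl (sup a b))"
  by (simp add: pcompl_pcompl_pcompl)

lift_definition Inf_regular_elt :: "'a regular_elt set \<Rightarrow> 'a regular_elt" is Inf
proof -
  fix A :: "'a set"
  assume "\<And>x. x \<in> A \<Longrightarrow> pcompl (pcompl x) = x"
  then have "pcompl (pcompl (Inf A)) \<le> Inf A"
    by (metis Inf_greatest Inf_lower pcompl_antimono)
  then show "pcompl (pcompl (Inf A)) = Inf A"
    by (simp add: antisym le_pcompl_pcompl)
qed

lift_definition Sup_regular_elt :: "'a regular_elt set \<Rightarrow> 'a regular_elt"
  is "\<lambda>A. pcompl (pcompl (Sup A))"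
  by (simp add: pcompl_pcompl_pcompl)

instance
proof
  fix x y z :: "'a regular_elt" and A :: "'a regular_elt set"
  show "(x < y) = (x \<le> y \<and> \<not> y \<le> x)"
    by transfer auto
  show "x \<le> x"
    by transfer simp
  show "x \<le> y \<Longrightarrow> y \<le> z \<Longrightarrow> x \<le> z"
    by transfer simp
  show "x \<le> y \<Longrightarrow> y \<le> x \<Longrightarrow> x = y"
    by transfer simp
  show "inf x y \<le> x" "inf x y \<le> y"
    by (transfer, simp)+
  show "x \<le> y \<Longrightarrow> x \<le> z \<Longrightarrow> x \<le> inf y z"
    by transfer simp
  show "x \<le> sup x y" "y \<le> sup x y"
    by (transfer, meson le_pcompl_pcompl order_trans sup_ge1 sup_ge2)+
  show "y \<le> x \<Longrightarrow> z \<le> x \<Longrightarrow> sup y z \<le> x"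
    by transfer (metis le_sup_iff pcompl_antimono)
  show "x \<in> A \<Longrightarrow> Inf A \<le> x"
    by transfer (simp add: Inf_lower)
  show "(\<And>x. x \<in> A \<Longrightarrow> z \<le> x) \<Longrightarrow> z \<le> Inf A"
    by transfer (simp add: Inf_greatest)
  show "x \<in> A \<Longrightarrow> x \<le> Sup A"
    by transfer (meson le_pcompl_pcompl order_trans Sup_upper)
  show "(\<And>x. x \<in> A \<Longrightarrow> x \<le> z) \<Longrightarrow> Sup A \<le> z"
    by transfer (metis Sup_least pcompl_antimono)
  show "Inf {} = (top :: 'a regular_elt)"
    by transfer simp
  show "Sup {} = (bot :: 'a regular_elt)"
    using bot_regular_elt.rep_eq bot_regular_elt.rsp
    by transfer (simp add: eq_onp_def)
next
  fix a :: "'a regular_elt" and B :: "'a regular_elt set"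
  show "inf a (Sup B) = (SUP b\<in>B. inf a b)"
  proof transfer
    fix a :: 'a and B :: "'a set"
    assume a: "pcompl (pcompl a) = a"
    let ?T = "SUP b\<in>B. inf a b"
    have "Sup B \<le> pcompl (inf a (pcompl ?T))"
    proof -
      have "inf (Sup B) (inf a (pcompl ?T)) = inf ?T (pcompl ?T)"
        unfolding inf_Sup_frame[symmetric] by (simp only: inf_aci)
      also have "\<dots> = bot"
        by (metis inf.commute le_pcompl_iff order_refl)
      finally show ?thesis
        by (simp add: le_pcompl_iff)
    qed
    then have "pcompl (pcompl (Sup B)) \<le> pcompl (inf a (pcompl ?T))"
      by (metis pcompl_antimono pcompl_pcompl_pcompl)
    then have 1: "inf a (pcompl (pcompl (Sup B))) \<le> pcompl (pcompl ?T)"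
      by (simp add: le_pcompl_iff inf.assoc inf.left_commute inf.commute)
    have "?T \<le> Sup B" "?T \<le> a"
      by (simp_all add: inf_Sup_frame[symmetric])
    then have "pcompl (pcompl ?T) \<le> inf a (pcompl (pcompl (Sup B)))"
      by (metis a le_inf_iff pcompl_antimono)
    with 1 show "inf a (pcompl (pcompl (Sup B))) = pcompl (pcompl ?T)"
      by (rule antisym)
  qed
qed

end

definition is_ideal :: "'a::{distrib_lattice,bounded_lattice} set \<Rightarrow> bool" where
  "is_ideal I \<longleftrightarrow> bot \<in> I \<and> (\<forall>a b. a \<in> I \<longrightarrow> b \<le> a \<longrightarrow> b \<in> I) \<and>
     (\<forall>a b. a \<in> I \<longrightarrow> b \<in> I \<longrightarrow> sup a b \<in> I)"

typedef (overloaded) 'a ideal = "{I :: 'a::{distrib_lattice,bounded_lattice} set. is_ideal I}"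
  morphisms elements Abs_ideal
  by (rule exI[of _ UNIV]) (simp add: is_ideal_def)

setup_lifting type_definition_ideal

instantiation ideal :: ("{distrib_lattice,bounded_lattice}") frame
begin

lift_definition less_eq_ideal :: "'a ideal \<Rightarrow> 'a ideal \<Rightarrow> bool" is "(\<subseteq>)" .

lift_definition less_ideal :: "'a ideal \<Rightarrow> 'a ideal \<Rightarrow> bool" is "(\<subset>)" .

lift_definition bot_ideal :: "'a ideal" is "{bot}"
  by (auto simp: is_ideal_def bot_unique)

lift_definition top_ideal :: "'a ideal" is UNIV
  by (simp add: is_ideal_def)

lift_definition inf_ideal :: "'a ideal \<Rightarrow> 'a ideal \<Rightarrow> 'a ideal" is "(\<inter>)"
  by (auto simp: is_ideal_def)

lift_definition Inf_ideal :: "'a ideal set \<Rightarrow> 'a ideal" is "\<lambda>S. \<Inter>S"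
  by (auto simp: is_ideal_def)

definition sup_ideal :: "'a ideal \<Rightarrow> 'a ideal \<Rightarrow> 'a ideal" where
  "sup_ideal I J = Inf {K. I \<le> K \<and> J \<le> K}"

definition Sup_ideal :: "'a ideal set \<Rightarrow> 'a ideal" where
  "Sup_ideal S = Inf {K. \<forall>I\<in>S. I \<le> K}"

instance
proof
  fix x y z :: "'a ideal" and A :: "'a ideal set"
  show "(x < y) = (x \<le> y \<and> \<not> y \<le> x)"
    by transfer auto
  show "x \<le> x"
    by transfer simp
  show "x \<le> y \<Longrightarrow> y \<le> z \<Longrightarrow> x \<le> z"
    by transfer blast
  show "x \<le> y \<Longrightarrow> y \<le> x \<Longrightarrow> x = y"
    by transfer blast
  show "inf x y \<le> x" "inf x y \<le> y"
    by (transfer, blast)+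
  show "x \<le> y \<Longrightarrow> x \<le> z \<Longrightarrow> x \<le> inf y z"
    by transfer blast
  have lower: "u \<in> B \<Longrightarrow> Inf B \<le> u" for u :: "'a ideal" and B
    by transfer blast
  have greatest: "(\<And>u. u \<in> B \<Longrightarrow> v \<le> u) \<Longrightarrow> v \<le> Inf B" for v :: "'a ideal" and B
    by transfer blast
  show "x \<in> A \<Longrightarrow> Inf A \<le> x"
    by (rule lower)
  show "(\<And>x. x \<in> A \<Longrightarrow> z \<le> x) \<Longrightarrow> z \<le> Inf A"
    by (rule greatest)
  show "x \<le> sup x y" "y \<le> sup x y"
    unfolding sup_ideal_def by (rule greatest, simp)+
  show "y \<le> x \<Longrightarrow> z \<le> x \<Longrightarrow> sup y z \<le> x"
    unfolding sup_ideal_def by (rule lower) simp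
  show "x \<in> A \<Longrightarrow> x \<le> Sup A"
    unfolding Sup_ideal_def by (rule greatest) simp
  show "(\<And>x. x \<in> A \<Longrightarrow> x \<le> z) \<Longrightarrow> Sup A \<le> z"
    unfolding Sup_ideal_def by (rule lower) simp
  show "Inf {} = (top :: 'a ideal)"
    by transfer simp
  have least: "bot \<le> u" for u :: "'a ideal"
    by transfer (simp add: is_ideal_def)
  show "Sup {} = (bot :: 'a ideal)"
  proof -
    have "Sup {} \<le> (bot :: 'a ideal)"
      unfolding Sup_ideal_def by (rule lower) simp
    with least[of "Sup {}"] show ?thesis
      unfolding less_eq_ideal.rep_eq by (simp add: elements_inject[symmetric])
  qed
next
  fix I :: "'a ideal" and S :: "'a ideal set"
  have trans: "u \<le> v \<Longrightarrow> v \<le> w \<Longrightarrow> u \<le> w" for u v w :: "'a ideal"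
    by transfer blast
  have lower: "u \<in> B \<Longrightarrow> Inf B \<le> u" for u :: "'a ideal" and B
    by transfer blast
  have greatest: "(\<And>u. u \<in> B \<Longrightarrow> v \<le> u) \<Longrightarrow> v \<le> Inf B" for v :: "'a ideal" and B
    by transfer blast
  have upper: "u \<in> B \<Longrightarrow> u \<le> Sup B" for u :: "'a ideal" and B
    unfolding Sup_ideal_def by (rule greatest) simp
  have least: "(\<And>u. u \<in> B \<Longrightarrow> u \<le> v) \<Longrightarrow> Sup B \<le> v" for v :: "'a ideal" and B
    unfolding Sup_ideal_def by (rule lower) simp
  have mono: "u \<le> v \<Longrightarrow> inf I u \<le> inf I v" for u v :: "'a ideal"
    by transfer blast
  let ?T = "SUP J\<in>S. inf I J"
  define K where "K = {x. \<forall>y\<in>elements I. inf x y \<in> elements ?T}"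
  have T: "is_ideal (elements ?T)"
    using elements by blast
  have "is_ideal K"
    unfolding is_ideal_def
  proof (intro conjI allI impI)
    show "bot \<in> K"
      using T by (simp add: K_def is_ideal_def)
    show "b \<in> K" if "a \<in> K" "b \<le> a" for a b
    proof -
      have "inf b y \<in> elements ?T" if "y \<in> elements I" for y
      proof -
        have "inf a y \<in> elements ?T"
          using \<open>a \<in> K\<close> that by (simp add: K_def)
        moreover have "inf b y \<le> inf a y"
          using \<open>b \<le> a\<close> by (simp add: le_infI1)
        ultimately show ?thesis
          using T unfolding is_ideal_def by blast
      qed
      then show ?thesis
        by (simp add: K_def)
    qed
    show "sup a b \<in> K" if "a \<in> K" "b \<in> K" for a b
      using T that by (simp add: K_def is_ideal_def inf_sup_distrib2)
  qed
  then have K: "elements (Abs_ideal K) = K"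
    by (simp add: Abs_ideal_inverse)
  have "J \<le> Abs_ideal K" if "J \<in> S" for J
  proof -
    have "inf I J \<le> ?T"
      using that by (intro upper) simp
    then have T': "elements I \<inter> elements J \<subseteq> elements ?T"
      by (simp add: less_eq_ideal.rep_eq inf_ideal.rep_eq)
    have "elements J \<subseteq> K"
    proof
      fix x assume x: "x \<in> elements J"
      have "is_ideal (elements I)" "is_ideal (elements J)"
        using elements by blast+
      then have "inf x y \<in> elements I \<inter> elements J" if "y \<in> elements I" for y
        using x that unfolding is_ideal_def by (meson IntI inf_le1 inf_le2)
      with T' show "x \<in> K"
        by (auto simp: K_def)
    qed
    then show ?thesis
      by (simp add: less_eq_ideal.rep_eq K)
  qed
  then have "Sup S \<le> Abs_ideal K"
    by (rule least)
  then have sub: "elements (Sup S) \<subseteq> K"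
    by (simp add: less_eq_ideal.rep_eq K)
  have 1: "inf I (Sup S) \<le> ?T"
  proof (simp only: less_eq_ideal.rep_eq inf_ideal.rep_eq, rule subsetI)
    fix x assume "x \<in> elements I \<inter> elements (Sup S)"
    with sub have "inf x x \<in> elements ?T"
      unfolding K_def by blast
    then show "x \<in> elements ?T"
      by simp
  qed
  have "?T \<le> inf I (Sup S)"
    by (rule least) (auto intro: mono upper)
  with 1 show "inf I (Sup S) = ?T"
    unfolding less_eq_ideal.rep_eq by (simp add: elements_inject[symmetric])
qed

end

lift_definition principal_ideal :: "'a::{distrib_lattice,bounded_lattice} \<Rightarrow> 'a ideal"
  is "\<lambda>x. {d. d \<le> x}"
  by (auto simp: is_ideal_def intro: order_trans)

definition is_prime_filter :: "'a::{distrib_lattice,bounded_lattice} set \<Rightarrow> bool" where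
  "is_prime_filter F \<longleftrightarrow> top \<in> F \<and> (\<forall>a b. a \<in> F \<longrightarrow> a \<le> b \<longrightarrow> b \<in> F) \<and>
     (\<forall>a b. a \<in> F \<longrightarrow> b \<in> F \<longrightarrow> inf a b \<in> F) \<and>
     bot \<notin> F \<and> (\<forall>a b. sup a b \<in> F \<longrightarrow> a \<in> F \<or> b \<in> F)"

definition stone_basic :: "'a::{distrib_lattice,bounded_lattice} \<Rightarrow> 'a set set" where
  "stone_basic d = {F. is_prime_filter F \<and> d \<in> F}"

definition stone_space :: "'a::{distrib_lattice,bounded_lattice} set topology" where
  "stone_space = topology (arbitrary union_of (\<lambda>U. U \<in> range stone_basic))"

lemma openin_stone_space:
  "openin stone_space = arbitrary union_of (\<lambda>U. U \<in> range stone_basic)"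
proof -
  have "stone_basic a \<inter> stone_basic b = stone_basic (inf a b)" for a b :: 'a
  proof -
    have "inf a b \<in> F \<longleftrightarrow> a \<in> F \<and> b \<in> F" if "is_prime_filter F" for F
      using that unfolding is_prime_filter_def by (meson inf_le1 inf_le2)
    then show ?thesis
      by (auto simp: stone_basic_def)
  qed
  then have "istopology (arbitrary union_of (\<lambda>U. U \<in> range (stone_basic :: 'a \<Rightarrow> _)))"
    by (intro istopology_base) auto
  then show ?thesis
    by (simp add: stone_space_def topology_inverse')
qed

lemma topspace_stone_space: "topspace stone_space = {F. is_prime_filter F}"
proof
  show "topspace stone_space \<subseteq> {F :: 'a set. is_prime_filter F}"
  proof
    fix F :: "'a set"
    assume "F \<in> topspace stone_space"
    then obtain \<U> where "\<U> \<subseteq> range stone_basic" "F \<in> \<Union>\<U>"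
      unfolding topspace_def openin_stone_space union_of_def by blast
    then show "F \<in> {F. is_prime_filter F}"
      by (auto simp: stone_basic_def)
  qed
  have "{F :: 'a set. is_prime_filter F} = stone_basic top"
    by (auto simp: stone_basic_def is_prime_filter_def)
  also have "openin stone_space \<dots>"
    unfolding openin_stone_space by (intro arbitrary_union_of_inc) simp
  finally show "{F :: 'a set. is_prime_filter F} \<subseteq> topspace stone_space"
    by (rule openin_subset)
qed

definition is_complemented :: "'a::bounded_lattice \<Rightarrow> bool" where
  "is_complemented x \<longleftrightarrow> (\<exists>y. inf x y = bot \<and> sup x y = top)"

typedef (overloaded) 'a complemented =
  "{x :: 'a::{distrib_lattice,bounded_lattice}. is_complemented x}"
  morphisms complemented_val Abs_complemented
  by (rule exI[of _ bot]) (simp add: is_complemented_def)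

setup_lifting type_definition_complemented

lemma is_complemented_inf:
  fixes x y :: "'a::{distrib_lattice,bounded_lattice}"
  assumes "is_complemented x" "is_complemented y"
  shows "is_complemented (inf x y)"
proof -
  obtain x' y' where *: "inf x x' = bot" "sup x x' = top" "inf y y' = bot" "sup y y' = top"
    using assms by (auto simp: is_complemented_def)
  have "inf (inf x y) (sup x' y') = bot"
  proof -
    have "inf (inf x y) (sup x' y') = sup (inf (inf x x') y) (inf x (inf y y'))"
      by (simp only: inf_sup_distrib1 inf_aci)
    then show ?thesis
      by (simp add: *)
  qed
  moreover have "sup (inf x y) (sup x' y') = top"
  proof -
    have "sup (inf x y) (sup x' y') = inf (sup (sup x x') y') (sup x' (sup y y'))"
      unfolding sup_inf_distrib2 by (simp only: sup_aci)
    then show ?thesis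
      by (simp add: *)
  qed
  ultimately show ?thesis
    by (auto simp: is_complemented_def)
qed

lemma is_complemented_sup:
  fixes x y :: "'a::{distrib_lattice,bounded_lattice}"
  assumes "is_complemented x" "is_complemented y"
  shows "is_complemented (sup x y)"
proof -
  obtain x' y' where *: "inf x x' = bot" "sup x x' = top" "inf y y' = bot" "sup y y' = top"
    using assms by (auto simp: is_complemented_def)
  have "sup (sup x y) (inf x' y') = top"
  proof -
    have "sup (sup x y) (inf x' y') = inf (sup (sup x x') y) (sup x (sup y y'))"
      by (simp only: sup_inf_distrib1 sup_aci)
    then show ?thesis
      by (simp add: *)
  qed
  moreover have "inf (sup x y) (inf x' y') = bot"
  proof -
    have "inf (sup x y) (inf x' y') = sup (inf (inf x x') y') (inf x' (inf y y'))"
      unfolding inf_sup_distrib2 by (simp only: inf_aci)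
    then show ?thesis
      by (simp add: *)
  qed
  ultimately show ?thesis
    by (auto simp: is_complemented_def)
qed

instantiation complemented :: ("{distrib_lattice,bounded_lattice}") "{distrib_lattice,bounded_lattice}"
begin

lift_definition less_eq_complemented :: "'a complemented \<Rightarrow> 'a complemented \<Rightarrow> bool" is "(\<le>)" .

lift_definition less_complemented :: "'a complemented \<Rightarrow> 'a complemented \<Rightarrow> bool" is "(<)" .

lift_definition bot_complemented :: "'a complemented" is bot
  by (simp add: is_complemented_def)

lift_definition top_complemented :: "'a complemented" is top
  by (simp add: is_complemented_def)

lift_definition inf_complemented :: "'a complemented \<Rightarrow> 'a complemented \<Rightarrow> 'a complemented" is inf
  by (rule is_complemented_inf)

lift_definition sup_complemented :: "'a complemented \<Rightarrow> 'a complemented \<Rightarrow> 'a complemented" is sup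
  by (rule is_complemented_sup)

instance
  by standard (transfer; simp add: sup_inf_distrib1 less_le_not_le)+

end

definition finite_join :: "('i \<Rightarrow> 'a::bounded_lattice) \<Rightarrow> 'i set \<Rightarrow> 'a" where
  "finite_join f K = Finite_Set.fold (\<lambda>k. sup (f k)) bot K"

lemma finite_join_empty: "finite_join f {} = bot"
  by (simp add: finite_join_def)

lemma finite_join_insert:
  assumes "finite K" "k \<notin> K"
  shows "finite_join f (insert k K) = sup (f k) (finite_join f K)"
proof -
  interpret comp_fun_commute "\<lambda>k. sup (f k)"
    by standard (simp add: fun_eq_iff sup.left_commute)
  show ?thesis
    using assms by (simp add: finite_join_def)
qed

definition lattice_isomorphism :: "('a::bounded_lattice \<Rightarrow> 'b::bounded_lattice) \<Rightarrow> bool" where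
  "lattice_isomorphism f \<longleftrightarrow> bij f \<and> f bot = bot \<and> f top = top \<and>
     (\<forall>x y. f (inf x y) = inf (f x) (f y)) \<and> (\<forall>x y. f (sup x y) = sup (f x) (f y))"

end

theory Submission
  imports Defs
begin

text \<open>
  Each condition says that \<open>\<not>I\<close> and \<open>\<not>\<not>I\<close> together cover the lattice, for every ideal \<open>I\<close>. Joins
  of ideals are computed by finite joins of elements, so the equation \<open>\<not>I \<or> \<not>\<not>I = 1\<close> between
  ideals amounts to a pair \<open>u \<in> \<not>I\<close>, \<open>v \<in> \<not>\<not>I\<close> with \<open>u \<or> v = 1\<close>
  (\<open>sup_ideal_eq_top_iff\<close>). This gives (ii) at once, since a finite cover by elements of two
  ideals can be sorted into two joins. It gives (iii) because the elements disjoint from a family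
  \<open>A\<close> form an ideal \<open>N\<close> with \<open>\<not>\<not>N = N\<close> (\<open>pcompl_pcompl_annihilator\<close>), while \<open>\<not>N\<close> is the
  set of elements all of whose non-zero parts meet \<open>A\<close>; the ideals of the form \<open>\<not>I\<close> arise in
  this way. It gives (iv) because the pair \<open>u, v\<close> is also disjoint, as \<open>\<not>I \<and> \<not>\<not>I = 0\<close>: so \<open>u\<close>
  and \<open>v\<close> are complements of each other, and they generate \<open>\<not>I\<close> and \<open>\<not>\<not>I\<close>
  (\<open>complementary_ideals_principal\<close>). Hence in the extremally disconnected case the regular
  ideals are the principal ideals of complemented elements, and \<open>x \<mapsto> {d. d \<le> x}\<close>, which always
  preserves and reflects the order, becomes an isomorphism.

  For the Stone space, an ideal \<open>I\<close> corresponds to the open set of prime filters that meet \<open>I\<close>.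
  The prime filter theorem, proved with Zorn's lemma, shows that this correspondence loses no
  information, and that the closure of the open set of \<open>I\<close> is the complement of the open set of
  \<open>\<not>I\<close> (\<open>closure_of_stone_open\<close>). The closure is therefore open exactly if \<open>\<not>I\<close> has a
  complement in the frame of ideals, which is then forced to be \<open>\<not>\<not>I\<close>.
\<close>

section \<open>Ideals and their joins\<close>

lemma is_ideal_elements: "is_ideal (elements I)"
  using elements by blast

lemma bot_mem_ideal: "bot \<in> elements I"
  using is_ideal_elements[of I] by (simp add: is_ideal_def)

lemma ideal_downward_closed: "a \<in> elements I \<Longrightarrow> b \<le> a \<Longrightarrow> b \<in> elements I"
  using is_ideal_elements[of I] unfolding is_ideal_def by blast

lemma sup_mem_ideal: "a \<in> elements I \<Longrightarrow> b \<in> elements I \<Longrightarrow> sup a b \<in> elements I"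
  using is_ideal_elements[of I] unfolding is_ideal_def by blast

lemma elements_Abs_ideal: "is_ideal I \<Longrightarrow> elements (Abs_ideal I) = I"
  by (simp add: Abs_ideal_inverse)

lemma ideal_eqI: "elements I = elements J \<Longrightarrow> I = J"
  by (simp add: elements_inject)

lemma ideal_eq_top_iff: "I = top \<longleftrightarrow> top \<in> elements I"
  by (metis UNIV_eq_I UNIV_I ideal_downward_closed ideal_eqI top_greatest top_ideal.rep_eq)

lemma mem_principal_ideal: "d \<in> elements (principal_ideal x) \<longleftrightarrow> d \<le> x"
  by (simp add: principal_ideal.rep_eq)

lemma is_ideal_below_sups:
  fixes I J :: "'a::{distrib_lattice,bounded_lattice} set"
  assumes I: "is_ideal I" and J: "is_ideal J"
  shows "is_ideal {x. \<exists>u\<in>I. \<exists>v\<in>J. x \<le> sup u v}"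
  unfolding is_ideal_def
proof (intro conjI allI impI)
  show "bot \<in> {x. \<exists>u\<in>I. \<exists>v\<in>J. x \<le> sup u v}"
    using I J by (auto simp: is_ideal_def)
next
  fix a b
  assume "a \<in> {x. \<exists>u\<in>I. \<exists>v\<in>J. x \<le> sup u v}" "b \<le> a"
  then show "b \<in> {x. \<exists>u\<in>I. \<exists>v\<in>J. x \<le> sup u v}"
    by (blast intro: order_trans)
next
  fix a b
  assume "a \<in> {x. \<exists>u\<in>I. \<exists>v\<in>J. x \<le> sup u v}" "b \<in> {x. \<exists>u\<in>I. \<exists>v\<in>J. x \<le> sup u v}"
  then obtain u v u' v' where *: "u \<in> I" "v \<in> J" "u' \<in> I" "v' \<in> J"
    "a \<le> sup u v" "b \<le> sup u' v'"
    by blast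
  have "sup a b \<le> sup (sup u u') (sup v v')"
    using sup_mono[OF *(5,6)] by (simp add: sup_aci)
  moreover have "sup u u' \<in> I" "sup v v' \<in> J"
    using * I J unfolding is_ideal_def by blast+
  ultimately show "sup a b \<in> {x. \<exists>u\<in>I. \<exists>v\<in>J. x \<le> sup u v}"
    by blast
qed

lemma mem_sup_ideal:
  "x \<in> elements (sup I J) \<longleftrightarrow> (\<exists>u\<in>elements I. \<exists>v\<in>elements J. x \<le> sup u v)"
proof
  define S where "S = {x. \<exists>u\<in>elements I. \<exists>v\<in>elements J. x \<le> sup u v}"
  have S: "elements (Abs_ideal S) = S"
    unfolding S_def by (intro elements_Abs_ideal is_ideal_below_sups is_ideal_elements)
  have "I \<le> Abs_ideal S" "J \<le> Abs_ideal S"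
    unfolding less_eq_ideal.rep_eq S unfolding S_def
    by (blast intro: bot_mem_ideal sup_ge1 sup_ge2)+
  then have "sup I J \<le> Abs_ideal S"
    by simp
  moreover assume "x \<in> elements (sup I J)"
  ultimately show "\<exists>u\<in>elements I. \<exists>v\<in>elements J. x \<le> sup u v"
    unfolding less_eq_ideal.rep_eq S unfolding S_def by blast
next
  have "I \<le> sup I J" "J \<le> sup I J"
    by simp_all
  then have "elements I \<subseteq> elements (sup I J)" "elements J \<subseteq> elements (sup I J)"
    by (simp_all only: less_eq_ideal.rep_eq)
  moreover assume "\<exists>u\<in>elements I. \<exists>v\<in>elements J. x \<le> sup u v"
  ultimately show "x \<in> elements (sup I J)"
    by (meson ideal_downward_closed subsetD sup_mem_ideal)
qed

lemma sup_ideal_eq_top_iff: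
  "sup I J = top \<longleftrightarrow> (\<exists>u\<in>elements I. \<exists>v\<in>elements J. sup u v = top)"
  unfolding ideal_eq_top_iff mem_sup_ideal by (simp add: top_unique)

section \<open>Finite covers by two ideals\<close>

lemma finite_join_mem_ideal:
  assumes "finite K" "\<And>k. k \<in> K \<Longrightarrow> a k \<in> elements I"
  shows "finite_join a K \<in> elements I"
  using assms
  by (induction K) (auto simp: finite_join_empty finite_join_insert bot_mem_ideal sup_mem_ideal)

lemma sup_ideal_eq_topI:
  assumes "finite K" "finite_join a K = top"
    and "\<And>k. k \<in> K \<Longrightarrow> a k \<in> elements I \<or> a k \<in> elements J"
  shows "sup I J = top"
proof -
  have "a k \<in> elements (sup I J)" if "k \<in> K" for k
    using assms(3)[OF that] unfolding mem_sup_ideal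
    by (blast intro: bot_mem_ideal sup_ge1 sup_ge2)
  then show ?thesis
    using finite_join_mem_ideal[OF assms(1)] assms(2) by (metis ideal_eq_top_iff)
qed

text \<open>
  Zero members can be left out of a cover. In the one-element lattice, where \<open>0 = 1\<close>, this leaves
  the empty cover.
\<close>

lemma sup_ideal_eq_top_iff_nonzero_cover:
  fixes I J :: "'a::{distrib_lattice,bounded_lattice} ideal"
  shows "sup I J = top \<longleftrightarrow> (\<exists>(K :: nat set) (a :: nat \<Rightarrow> 'a).
    finite K \<and> (\<forall>k\<in>K. a k \<noteq> bot) \<and> finite_join a K = top \<and>
    (\<forall>k\<in>K. a k \<in> elements I \<or> a k \<in> elements J))" (is "_ \<longleftrightarrow> ?cover")
proof
  assume "sup I J = top"
  then obtain u v where uv: "u \<in> elements I" "v \<in> elements J" "sup u v = top"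
    unfolding sup_ideal_eq_top_iff by blast
  define a where "a k = (if k = 0 then u else v)" for k :: nat
  define K where "K = (if u = bot then {} else {0}) \<union> (if v = bot then {} else {1::nat})"
  have "finite_join a K = sup u v"
    by (auto simp: K_def a_def finite_join_empty finite_join_insert sup_commute)
  moreover have "finite K" "\<forall>k\<in>K. a k \<noteq> bot" "\<forall>k\<in>K. a k \<in> elements I \<or> a k \<in> elements J"
    using uv by (auto simp: K_def a_def)
  ultimately show ?cover
    using uv(3) by (intro exI[of _ K] exI[of _ a]) simp
next
  assume ?cover
  then show "sup I J = top"
    by (elim exE conjE) (rule sup_ideal_eq_topI, auto)
qed

lemma sup_ideal_eq_top_iff_cover:
  fixes I J :: "'a::{distrib_lattice,bounded_lattice} ideal"
  shows "sup I J = top \<longleftrightarrow> (\<exists>(K :: nat set) (a :: nat \<Rightarrow> 'a).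
    finite K \<and> finite_join a K = top \<and> (\<forall>k\<in>K. a k \<in> elements I \<or> a k \<in> elements J))"
    (is "_ \<longleftrightarrow> ?cover")
proof
  assume "sup I J = top"
  then show ?cover
    unfolding sup_ideal_eq_top_iff_nonzero_cover by (elim exE conjE) (intro exI conjI)
next
  assume ?cover
  then show "sup I J = top"
    by (elim exE conjE) (rule sup_ideal_eq_topI, auto)
qed

section \<open>Pseudocomplements of ideals\<close>

lemma mem_pcompl_ideal:
  "a \<in> elements (pcompl I) \<longleftrightarrow> (\<forall>b. b \<noteq> bot \<longrightarrow> b \<le> a \<longrightarrow> b \<notin> elements I)"
proof -
  have "a \<in> elements (pcompl I) \<longleftrightarrow> principal_ideal a \<le> pcompl I"
    unfolding less_eq_ideal.rep_eq
    by (metis ideal_downward_closed mem_principal_ideal order_refl subsetD subsetI)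
  also have "\<dots> \<longleftrightarrow> elements (inf (principal_ideal a) I) = elements bot"
    by (simp add: le_pcompl_iff elements_inject)
  also have "\<dots> \<longleftrightarrow> {d. d \<le> a} \<inter> elements I = {bot}"
    by (simp add: inf_ideal.rep_eq principal_ideal.rep_eq bot_ideal.rep_eq)
  also have "\<dots> \<longleftrightarrow> (\<forall>b. b \<noteq> bot \<longrightarrow> b \<le> a \<longrightarrow> b \<notin> elements I)"
    using bot_mem_ideal[of I] by auto
  finally show ?thesis .
qed

lemma mem_pcompl_pcompl_ideal:
  "a \<in> elements (pcompl (pcompl I)) \<longleftrightarrow>
    (\<forall>b. b \<noteq> bot \<longrightarrow> b \<le> a \<longrightarrow> (\<exists>c\<in>elements I. c \<noteq> bot \<and> c \<le> b))"
  unfolding mem_pcompl_ideal by blast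

lemma mem_pcompl_ideal_iff_disjoint:
  "a \<in> elements (pcompl I) \<longleftrightarrow> (\<forall>i\<in>elements I. inf a i = bot)"
proof
  assume "a \<in> elements (pcompl I)"
  then show "\<forall>i\<in>elements I. inf a i = bot"
    unfolding mem_pcompl_ideal by (meson ideal_downward_closed inf_le1 inf_le2)
next
  assume *: "\<forall>i\<in>elements I. inf a i = bot"
  show "a \<in> elements (pcompl I)"
    unfolding mem_pcompl_ideal using * by (metis inf.absorb2)
qed

lemma regular_ideal_iff:
  "pcompl (pcompl I) = I \<longleftrightarrow>
    (\<forall>a. (\<forall>b. b \<noteq> bot \<longrightarrow> b \<le> a \<longrightarrow> (\<exists>c\<in>elements I. c \<noteq> bot \<and> c \<le> b)) \<longrightarrow> a \<in> elements I)"
  unfolding mem_pcompl_pcompl_ideal[symmetric]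
  by (metis antisym le_pcompl_pcompl less_eq_ideal.rep_eq subsetD subsetI)

lemma inf_pcompl_eq_bot: "inf (pcompl a) a = bot" for a :: "'a::frame"
  using le_pcompl_iff[of "pcompl a" a] by simp

lemma inf_eq_bot_mono:
  fixes a b c d :: "'a::bounded_lattice"
  assumes "inf a b = bot" "c \<le> a" "d \<le> b"
  shows "inf c d = bot"
  using inf_mono[OF assms(2,3)] assms(1) by (simp add: bot_unique)

lemma disjoint_of_disjoint_ideals:
  assumes "inf I J = bot" "u \<in> elements I" "v \<in> elements J"
  shows "inf u v = bot"
proof -
  have "inf u v \<in> elements (inf I J)"
    using assms(2,3) unfolding inf_ideal.rep_eq
    by (meson IntI ideal_downward_closed inf_le1 inf_le2)
  then show ?thesis
    by (simp add: assms(1) bot_ideal.rep_eq)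
qed

text \<open>
  An element \<open>d\<close> of \<open>I\<close> is disjoint from \<open>v\<close>, and \<open>u \<or> v = 1\<close>, so it lies below \<open>u\<close>.
\<close>

lemma complementary_ideals_principal:
  fixes I J :: "'a::{distrib_lattice,bounded_lattice} ideal"
  assumes "inf I J = bot" "u \<in> elements I" "v \<in> elements J" "sup u v = top"
  shows "I = principal_ideal u" "is_complemented u"
proof -
  have "d \<le> u" if "d \<in> elements I" for d
  proof -
    have "d = inf d (sup u v)"
      by (simp add: assms(4))
    also have "\<dots> = sup (inf d u) (inf d v)"
      by (rule inf_sup_distrib1)
    also have "\<dots> = inf d u"
      using disjoint_of_disjoint_ideals[OF assms(1) that assms(3)] by simp
    finally show ?thesis
      by (metis inf_le2)
  qed
  then show "I = principal_ideal u"
    using assms(2)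
    by (intro ideal_eqI) (auto simp: principal_ideal.rep_eq intro: ideal_downward_closed)
  show "is_complemented u"
    using disjoint_of_disjoint_ideals[OF assms(1-3)] assms(4) by (auto simp: is_complemented_def)
qed

lemma pcompl_principal_ideal:
  assumes "inf x y = bot" "sup x y = top"
  shows "pcompl (principal_ideal x) = principal_ideal y"
proof -
  have y: "y \<in> elements (pcompl (principal_ideal x))"
    unfolding mem_pcompl_ideal_iff_disjoint principal_ideal.rep_eq
    using inf_eq_bot_mono[of y x y] assms(1) by (simp add: inf.commute)
  have x: "x \<in> elements (principal_ideal x)"
    by (simp add: mem_principal_ideal)
  have "sup y x = top"
    using assms(2) by (simp add: sup.commute)
  then show ?thesis
    by (rule complementary_ideals_principal(1)[OF inf_pcompl_eq_bot y x])
qed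

lemma pcompl_pcompl_principal_ideal:
  assumes "is_complemented x"
  shows "pcompl (pcompl (principal_ideal x)) = principal_ideal x"
proof -
  obtain y where y: "inf x y = bot" "sup x y = top"
    using assms unfolding is_complemented_def by blast
  then have "inf y x = bot" "sup y x = top"
    by (simp_all add: inf.commute sup.commute)
  then show ?thesis
    using pcompl_principal_ideal[of x y] pcompl_principal_ideal[of y x] y by simp
qed

section \<open>The condition on families of elements\<close>

definition annihilator :: "'a::{distrib_lattice,bounded_lattice} set \<Rightarrow> 'a ideal" where
  "annihilator A = Abs_ideal {x. \<forall>a\<in>A. inf x a = bot}"

lemma mem_annihilator: "x \<in> elements (annihilator A) \<longleftrightarrow> (\<forall>a\<in>A. inf x a = bot)"
proof -
  have "inf y a = bot" if "inf x a = bot" "y \<le> x" for x y a :: 'a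
    using that by (auto intro: inf_eq_bot_mono)
  then have "is_ideal {x. \<forall>a\<in>A. inf x a = bot}"
    by (auto simp: is_ideal_def inf_sup_distrib2)
  then show ?thesis
    by (simp add: annihilator_def elements_Abs_ideal)
qed

lemma mem_pcompl_annihilator:
  "b \<in> elements (pcompl (annihilator A)) \<longleftrightarrow>
    (\<forall>x. x \<noteq> bot \<longrightarrow> x \<le> b \<longrightarrow> (\<exists>a\<in>A. inf x a \<noteq> bot))"
  unfolding mem_pcompl_ideal mem_annihilator by blast

text \<open>
  If \<open>b\<close> were not disjoint from some \<open>a \<in> A\<close>, the non-zero element \<open>b \<and> a\<close> would have a non-zero
  part that annihilates \<open>A\<close>, although that part lies below \<open>a\<close>.
\<close>

lemma pcompl_pcompl_annihilator: "pcompl (pcompl (annihilator A)) = annihilator A"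
proof -
  have "inf b a = bot" if b: "b \<in> elements (pcompl (pcompl (annihilator A)))" and a: "a \<in> A" for a b
  proof (rule ccontr)
    assume "inf b a \<noteq> bot"
    then obtain c where c: "c \<in> elements (annihilator A)" "c \<noteq> bot" "c \<le> inf b a"
      using b unfolding mem_pcompl_pcompl_ideal by (meson inf_le1)
    then have "inf c a = c"
      by (simp add: inf.absorb1)
    then show False
      using c a by (simp add: mem_annihilator)
  qed
  then have "pcompl (pcompl (annihilator A)) \<le> annihilator A"
    by (auto simp: less_eq_ideal.rep_eq mem_annihilator)
  then show ?thesis
    by (simp add: antisym le_pcompl_pcompl)
qed

lemma annihilator_nonzero_elements: "annihilator (elements I - {bot}) = pcompl I"
proof (rule ideal_eqI, rule set_eqI)
  fix x
  have "(\<forall>a\<in>elements I - {bot}. inf x a = bot) \<longleftrightarrow> (\<forall>a\<in>elements I. inf x a = bot)"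
    using inf_bot_right[of x] by blast
  then show "x \<in> elements (annihilator (elements I - {bot})) \<longleftrightarrow> x \<in> elements (pcompl I)"
    by (simp add: mem_annihilator mem_pcompl_ideal_iff_disjoint)
qed

section \<open>The lattice-theoretic characterizations\<close>

text \<open>
  Triple negation makes every \<open>\<not>a\<close> regular, and a regular \<open>a\<close> is the negation of \<open>\<not>a\<close>; so the
  regular elements are exactly the negations.
\<close>

lemma extremally_disconnected_iff_regular:
  "extremally_disconnected_locale TYPE('a::frame) \<longleftrightarrow>
    (\<forall>a::'a. pcompl (pcompl a) = a \<longrightarrow> sup a (pcompl a) = top)"
  unfolding extremally_disconnected_locale_def by (metis pcompl_pcompl_pcompl sup.commute)

lemma extremally_disconnected_iff_ideal_covers:
  "extremally_disconnected_locale TYPE('a::{distrib_lattice,bounded_lattice} ideal) \<longleftrightarrow>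
    (\<forall>I :: 'a ideal. \<exists>(K :: nat set) (a :: nat \<Rightarrow> 'a).
       finite K \<and> finite_join a K = top \<and>
       (\<forall>k\<in>K. a k \<in> elements (pcompl I) \<or> a k \<in> elements (pcompl (pcompl I))))"
  unfolding extremally_disconnected_locale_def sup_ideal_eq_top_iff_cover ..

text \<open>
  For a fixed family \<open>A\<close> the condition says that its annihilator, a regular ideal, covers together
  with its negation. The families of all non-zero elements of an ideal suffice for the converse.
\<close>

lemma extremally_disconnected_iff_family_covers:
  "extremally_disconnected_locale TYPE('a::{distrib_lattice,bounded_lattice} ideal) \<longleftrightarrow>
    (\<forall>A :: 'a set. bot \<notin> A \<longrightarrow>
       (\<exists>(J :: nat set) (b :: nat \<Rightarrow> 'a).
          finite J \<and> (\<forall>j\<in>J. b j \<noteq> bot) \<and> finite_join b J = top \<and>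
          (\<forall>j\<in>J. (\<forall>a\<in>A. inf (b j) a = bot) \<or>
             (\<forall>x. x \<noteq> bot \<longrightarrow> x \<le> b j \<longrightarrow> (\<exists>a\<in>A. inf x a \<noteq> bot)))))"
    (is "_ \<longleftrightarrow> (\<forall>A. bot \<notin> A \<longrightarrow> ?covered A)")
proof -
  have covered: "?covered A \<longleftrightarrow> sup (annihilator A) (pcompl (annihilator A)) = top" for A :: "'a set"
    unfolding mem_annihilator[symmetric] mem_pcompl_annihilator[symmetric]
    by (rule sup_ideal_eq_top_iff_nonzero_cover[symmetric])
  show ?thesis
  proof
    assume "extremally_disconnected_locale TYPE('a ideal)"
    then show "\<forall>A :: 'a set. bot \<notin> A \<longrightarrow> ?covered A"
      unfolding covered extremally_disconnected_iff_regular
      by (simp add: pcompl_pcompl_annihilator)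
  next
    assume A: "\<forall>A :: 'a set. bot \<notin> A \<longrightarrow> ?covered A"
    show "extremally_disconnected_locale TYPE('a ideal)"
      unfolding extremally_disconnected_locale_def
    proof
      fix I :: "'a ideal"
      have "?covered (elements I - {bot})"
        using A by blast
      then show "sup (pcompl I) (pcompl (pcompl I)) = top"
        unfolding covered annihilator_nonzero_elements .
    qed
  qed
qed

text \<open>
  A regular ideal and its negation are disjoint, so they cover exactly if they are generated by two
  mutually complementary elements.
\<close>

lemma extremally_disconnected_iff_regular_principal:
  "extremally_disconnected_locale TYPE('a::{distrib_lattice,bounded_lattice} ideal) \<longleftrightarrow>
    (\<forall>I :: 'a ideal. pcompl (pcompl I) = I \<longrightarrow>
      (\<exists>x. is_complemented x \<and> I = principal_ideal x))"
proof -
  have "sup I (pcompl I) = top \<longleftrightarrow> (\<exists>x. is_complemented x \<and> I = principal_ideal x)"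
    for I :: "'a ideal"
  proof
    assume "sup I (pcompl I) = top"
    then obtain u v where "u \<in> elements I" "v \<in> elements (pcompl I)" "sup u v = top"
      unfolding sup_ideal_eq_top_iff by blast
    moreover have "inf I (pcompl I) = bot"
      using inf_pcompl_eq_bot[of I] by (simp add: inf.commute)
    ultimately show "\<exists>x. is_complemented x \<and> I = principal_ideal x"
      using complementary_ideals_principal by blast
  next
    assume "\<exists>x. is_complemented x \<and> I = principal_ideal x"
    then obtain x y where "I = principal_ideal x" "inf x y = bot" "sup x y = top"
      unfolding is_complemented_def by blast
    then show "sup I (pcompl I) = top"
      unfolding sup_ideal_eq_top_iff
      by (metis mem_principal_ideal order_refl pcompl_principal_ideal)
  qed
  then show ?thesis
    unfolding extremally_disconnected_iff_regular by simp
qed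

section \<open>Complemented elements and regular ideals\<close>

lemma lattice_isomorphism_if_order_isomorphism:
  fixes f :: "'a::bounded_lattice \<Rightarrow> 'b::bounded_lattice"
  assumes "surj f" and le: "\<And>x y. f x \<le> f y \<longleftrightarrow> x \<le> y"
  shows "lattice_isomorphism f"
proof -
  have onto: "\<exists>z. w = f z" for w
    using \<open>surj f\<close> by (rule surjD)
  have "inj f"
    by (rule injI, rule antisym) (simp_all flip: le)
  moreover have "f bot = bot"
    using onto[of bot] by (metis bot_least bot_unique le)
  moreover have "f top = top"
    using onto[of top] by (metis top_greatest top_unique le)
  moreover have "f (inf x y) = inf (f x) (f y)" for x y
  proof (rule antisym)
    obtain z where z: "inf (f x) (f y) = f z"
      using onto by blast
    have "f z \<le> f x" "f z \<le> f y"
      by (simp_all flip: z)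
    then show "inf (f x) (f y) \<le> f (inf x y)"
      by (simp add: z le)
  qed (simp add: le)
  moreover have "f (sup x y) = sup (f x) (f y)" for x y
  proof (rule antisym)
    obtain z where z: "sup (f x) (f y) = f z"
      using onto by blast
    have "f x \<le> f z" "f y \<le> f z"
      by (simp_all flip: z)
    then show "f (sup x y) \<le> sup (f x) (f y)"
      by (simp add: z le)
  qed (simp add: le)
  ultimately show ?thesis
    using \<open>surj f\<close> by (simp add: lattice_isomorphism_def bij_def)
qed

lemma complemented_isomorphic_regular_ideals:
  assumes "extremally_disconnected_locale TYPE('a::{distrib_lattice,bounded_lattice} ideal)"
  shows "\<exists>f :: 'a complemented \<Rightarrow> 'a ideal regular_elt. lattice_isomorphism f \<and>
    (\<forall>x. regular_val (f x) = principal_ideal (complemented_val x))"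
proof -
  define f :: "'a complemented \<Rightarrow> 'a ideal regular_elt"
    where "f x = Abs_regular_elt (principal_ideal (complemented_val x))" for x
  have f: "regular_val (f x) = principal_ideal (complemented_val x)" for x
    using complemented_val[of x]
    by (simp add: f_def Abs_regular_elt_inverse pcompl_pcompl_principal_ideal)
  have "surj f"
  proof (rule surjI[of f])
    fix J :: "'a ideal regular_elt"
    have "pcompl (pcompl (regular_val J)) = regular_val J"
      using regular_val[of J] by simp
    then obtain x where "is_complemented x" "regular_val J = principal_ideal x"
      using assms unfolding extremally_disconnected_iff_regular_principal by blast
    then have "f (Abs_complemented x) = J"
      by (simp add: regular_val_inject[symmetric] f Abs_complemented_inverse)
    then show "f (SOME x. f x = J) = J"
      by (rule someI)
  qed
  moreover have "f x \<le> f y \<longleftrightarrow> x \<le> y" for x y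
    unfolding less_eq_regular_elt.rep_eq less_eq_complemented.rep_eq f less_eq_ideal.rep_eq
    by (auto simp: principal_ideal.rep_eq intro: order_trans)
  ultimately show ?thesis
    using f lattice_isomorphism_if_order_isomorphism by blast
qed

section \<open>The prime filter theorem\<close>

text \<open>
  The complement of an ideal that is maximal among those avoiding \<open>d\<close> is a prime filter. Maximality
  makes it closed under meets: if \<open>a\<close> and \<open>b\<close> lie outside the maximal ideal \<open>M\<close>, then
  \<open>d \<le> m \<or> a\<close> and \<open>d \<le> n \<or> b\<close> with \<open>m, n \<in> M\<close>, hence \<open>d \<le> (m \<or> n) \<or> (a \<and> b)\<close> by
  distributivity, and \<open>a \<and> b \<in> M\<close> would put \<open>d\<close> into \<open>M\<close>.
\<close>

lemma prime_filter_extends: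
  fixes I :: "'a::{distrib_lattice,bounded_lattice} ideal"
  assumes "d \<notin> elements I"
  obtains F where "is_prime_filter F" "d \<in> F" "F \<inter> elements I = {}"
proof -
  let ?S = "{J. is_ideal J \<and> elements I \<subseteq> J \<and> d \<notin> J}"
  have "\<exists>M\<in>?S. \<forall>X\<in>?S. M \<subseteq> X \<longrightarrow> X = M"
  proof (rule subset_Zorn_nonempty)
    show "?S \<noteq> {}"
      using assms is_ideal_elements[of I] by blast
  next
    fix \<C>
    assume "\<C> \<noteq> {}" and chain: "subset.chain ?S \<C>"
    then have C: "is_ideal J" "elements I \<subseteq> J" "d \<notin> J" if "J \<in> \<C>" for J
      using that by (auto simp: subset_chain_def)
    have "is_ideal (\<Union>\<C>)"
      unfolding is_ideal_def
    proof (intro conjI allI impI)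
      show "bot \<in> \<Union>\<C>"
        using \<open>\<C> \<noteq> {}\<close> C(1) by (auto simp: is_ideal_def)
      show "b \<in> \<Union>\<C>" if "a \<in> \<Union>\<C>" "b \<le> a" for a b
        using that C(1) unfolding is_ideal_def by blast
      show "sup a b \<in> \<Union>\<C>" if "a \<in> \<Union>\<C>" "b \<in> \<Union>\<C>" for a b
      proof -
        obtain J J' where "J \<in> \<C>" "J' \<in> \<C>" "a \<in> J" "b \<in> J'"
          using \<open>a \<in> \<Union>\<C>\<close> \<open>b \<in> \<Union>\<C>\<close> by blast
        moreover have "J \<subseteq> J' \<or> J' \<subseteq> J"
          using chain calculation unfolding subset_chain_def by blast
        ultimately obtain L where "L \<in> \<C>" "a \<in> L" "b \<in> L"
          by blast
        then show ?thesis
          using C(1) unfolding is_ideal_def by blast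
      qed
    qed
    then show "\<Union>\<C> \<in> ?S"
      using C \<open>\<C> \<noteq> {}\<close> by blast
  qed
  then obtain M where "M \<in> ?S" and max: "\<forall>X\<in>?S. M \<subseteq> X \<longrightarrow> X = M"
    by (rule bexE)
  then have M: "is_ideal M" "elements I \<subseteq> M" "d \<notin> M"
    by simp_all
  have bot: "bot \<in> M" and down: "\<And>a b. a \<in> M \<Longrightarrow> b \<le> a \<Longrightarrow> b \<in> M"
    and sup: "\<And>a b. a \<in> M \<Longrightarrow> b \<in> M \<Longrightarrow> sup a b \<in> M"
    using M(1) unfolding is_ideal_def by blast+
  have reach: "\<exists>m\<in>M. d \<le> sup m a" if "a \<notin> M" for a
  proof (rule ccontr)
    assume no: "\<not> (\<exists>m\<in>M. d \<le> sup m a)"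
    let ?X = "{x. \<exists>u\<in>M. \<exists>v\<in>{v. v \<le> a}. x \<le> sup u v}"
    have "is_ideal ?X"
      using M(1) is_ideal_elements[of "principal_ideal a"]
      by (intro is_ideal_below_sups) (simp_all add: principal_ideal.rep_eq)
    moreover have "M \<subseteq> ?X"
      using le_supI1[OF order_refl] by blast
    moreover have "d \<notin> ?X"
    proof
      assume "d \<in> ?X"
      then obtain u v where "u \<in> M" "v \<le> a" "d \<le> sup u v"
        by blast
      then have "d \<le> sup u a"
        using order_trans[OF _ sup_mono[OF order_refl]] by blast
      then show False
        using no \<open>u \<in> M\<close> by blast
    qed
    moreover have "elements I \<subseteq> ?X"
      using M(2) \<open>M \<subseteq> ?X\<close> by (rule subset_trans)
    ultimately have "?X = M"
      using max by simp
    moreover have "a \<in> ?X"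
      using bot le_supI2[OF order_refl] by blast
    ultimately show False
      using that by simp
  qed
  have "is_prime_filter (- M)"
    unfolding is_prime_filter_def
  proof (intro conjI allI impI)
    show "top \<in> - M"
      using M(3) down top_greatest by blast
    show "b \<in> - M" if "a \<in> - M" "a \<le> b" for a b
      using that down by blast
    show "inf a b \<in> - M" if "a \<in> - M" "b \<in> - M" for a b
    proof
      assume ab: "inf a b \<in> M"
      obtain m n where mn: "m \<in> M" "n \<in> M" "d \<le> sup m a" "d \<le> sup n b"
        using reach \<open>a \<in> - M\<close> \<open>b \<in> - M\<close> by blast
      have "d \<le> sup (sup m n) a"
        by (rule order_trans[OF mn(3)]) (simp add: le_supI1)
      moreover have "d \<le> sup (sup m n) b"
        by (rule order_trans[OF mn(4)]) (simp add: le_supI1)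
      ultimately have "d \<le> sup (sup m n) (inf a b)"
        by (simp add: sup_inf_distrib1)
      then show False
        using down[OF sup[OF sup[OF mn(1,2)] ab]] M(3) by blast
    qed
    show "bot \<notin> - M"
      using bot by simp
    show "a \<in> - M \<or> b \<in> - M" if "sup a b \<in> - M" for a b
      using that sup by blast
  qed
  then show ?thesis
    by (rule that) (use M in auto)
qed

lemma prime_filter_of_nonzero:
  fixes d :: "'a::{distrib_lattice,bounded_lattice}"
  assumes "d \<noteq> bot"
  obtains F where "is_prime_filter F" "d \<in> F"
proof -
  have "d \<notin> elements bot"
    using assms by (simp add: bot_ideal.rep_eq)
  then show ?thesis
    using that by (rule prime_filter_extends)
qed

lemma bot_notin_prime_filter: "is_prime_filter F \<Longrightarrow> bot \<notin> F"
  by (simp add: is_prime_filter_def)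

lemma top_mem_prime_filter: "is_prime_filter F \<Longrightarrow> top \<in> F"
  by (simp add: is_prime_filter_def)

lemma prime_filter_inf_iff: "is_prime_filter F \<Longrightarrow> inf a b \<in> F \<longleftrightarrow> a \<in> F \<and> b \<in> F"
  unfolding is_prime_filter_def by (meson inf_le1 inf_le2)

lemma prime_filter_sup_iff: "is_prime_filter F \<Longrightarrow> sup a b \<in> F \<longleftrightarrow> a \<in> F \<or> b \<in> F"
  unfolding is_prime_filter_def by (meson sup_ge1 sup_ge2)

section \<open>Open sets of the Stone space\<close>

definition stone_open :: "'a::{distrib_lattice,bounded_lattice} ideal \<Rightarrow> 'a set set" where
  "stone_open I = {F. is_prime_filter F \<and> F \<inter> elements I \<noteq> {}}"

lemma openin_stone_basic: "openin stone_space (stone_basic d)"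
  unfolding openin_stone_space by (intro arbitrary_union_of_inc) simp

lemma openin_stone_open: "openin stone_space (stone_open I)"
proof -
  have "stone_open I = \<Union> (stone_basic ` elements I)"
    by (auto simp: stone_open_def stone_basic_def)
  then show ?thesis
    by (metis (no_types, lifting) imageE openin_Union openin_stone_basic)
qed

lemma stone_basic_subset_of_openin:
  assumes "openin stone_space U" "F \<in> U"
  obtains d where "F \<in> stone_basic d" "stone_basic d \<subseteq> U"
proof -
  obtain \<U> where "\<U> \<subseteq> range stone_basic" "\<Union>\<U> = U"
    using assms(1) unfolding openin_stone_space union_of_def by blast
  then show ?thesis
    using assms(2) that by (metis UnionE Union_upper rangeE subsetD)
qed

text \<open>The ideal of an open set \<open>U\<close> consists of the \<open>d\<close> whose basic open set is contained in \<open>U\<close>.\<close>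

lemma stone_open_of_openin:
  fixes U :: "'a::{distrib_lattice,bounded_lattice} set set"
  assumes "openin stone_space U"
  obtains I where "U = stone_open I"
proof -
  have "is_ideal {d. stone_basic d \<subseteq> U}"
    unfolding is_ideal_def
  proof (intro conjI allI impI)
    show "bot \<in> {d. stone_basic d \<subseteq> U}"
      by (auto simp: stone_basic_def is_prime_filter_def)
    show "b \<in> {d. stone_basic d \<subseteq> U}" if "a \<in> {d. stone_basic d \<subseteq> U}" "b \<le> a" for a b
    proof -
      have "stone_basic b \<subseteq> stone_basic a"
        using \<open>b \<le> a\<close> unfolding stone_basic_def is_prime_filter_def by blast
      then show ?thesis
        using that(1) by blast
    qed
    show "sup a b \<in> {d. stone_basic d \<subseteq> U}"
      if "a \<in> {d. stone_basic d \<subseteq> U}" "b \<in> {d. stone_basic d \<subseteq> U}" for a b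
    proof -
      have "stone_basic (sup a b) \<subseteq> stone_basic a \<union> stone_basic b"
        using prime_filter_sup_iff unfolding stone_basic_def by blast
      then show ?thesis
        using that by blast
    qed
  qed
  then have I: "elements (Abs_ideal {d. stone_basic d \<subseteq> U}) = {d. stone_basic d \<subseteq> U}"
    by (rule elements_Abs_ideal)
  have "U = stone_open (Abs_ideal {d. stone_basic d \<subseteq> U})"
  proof
    show "U \<subseteq> stone_open (Abs_ideal {d. stone_basic d \<subseteq> U})"
    proof
      fix F
      assume "F \<in> U"
      then obtain d where "F \<in> stone_basic d" "stone_basic d \<subseteq> U"
        using stone_basic_subset_of_openin[OF assms] by blast
      then show "F \<in> stone_open (Abs_ideal {d. stone_basic d \<subseteq> U})"
        unfolding stone_open_def I by (auto simp: stone_basic_def)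
    qed
    show "stone_open (Abs_ideal {d. stone_basic d \<subseteq> U}) \<subseteq> U"
      unfolding stone_open_def I by (auto simp: stone_basic_def)
  qed
  then show ?thesis
    by (rule that)
qed

lemma stone_open_eq_empty_iff: "stone_open I = {} \<longleftrightarrow> I = bot"
proof
  assume empty: "stone_open I = {}"
  have "d = bot" if "d \<in> elements I" for d
  proof (rule ccontr)
    assume "d \<noteq> bot"
    then obtain F where "is_prime_filter F" "d \<in> F"
      by (rule prime_filter_of_nonzero)
    then show False
      using empty that by (auto simp: stone_open_def)
  qed
  then show "I = bot"
    using bot_mem_ideal[of I] by (intro ideal_eqI) (auto simp: bot_ideal.rep_eq)
qed (simp add: stone_open_def bot_ideal.rep_eq bot_notin_prime_filter)

lemma stone_open_eq_topspace_iff: "stone_open I = topspace stone_space \<longleftrightarrow> I = top"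
proof
  assume all: "stone_open I = topspace stone_space"
  have "top \<in> elements I"
  proof (rule ccontr)
    assume "top \<notin> elements I"
    then obtain F where "is_prime_filter F" "F \<inter> elements I = {}"
      by (rule prime_filter_extends)
    then have "F \<in> topspace stone_space - stone_open I"
      by (simp add: topspace_stone_space stone_open_def)
    then show False
      by (simp add: all)
  qed
  then show "I = top"
    by (simp add: ideal_eq_top_iff)
next
  assume "I = top"
  then show "stone_open I = topspace stone_space"
    using top_mem_prime_filter by (auto simp: stone_open_def topspace_stone_space top_ideal.rep_eq)
qed

lemma stone_open_inf: "stone_open (inf I J) = stone_open I \<inter> stone_open J"
proof -
  have "F \<inter> elements (inf I J) \<noteq> {} \<longleftrightarrow> F \<inter> elements I \<noteq> {} \<and> F \<inter> elements J \<noteq> {}"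
    if F: "is_prime_filter F" for F
  proof
    assume "F \<inter> elements I \<noteq> {} \<and> F \<inter> elements J \<noteq> {}"
    then obtain i j where "i \<in> F" "i \<in> elements I" "j \<in> F" "j \<in> elements J"
      by blast
    then have "inf i j \<in> F" "inf i j \<in> elements I" "inf i j \<in> elements J"
      using prime_filter_inf_iff[OF F] ideal_downward_closed[OF _ inf_le1]
        ideal_downward_closed[OF _ inf_le2] by blast+
    then show "F \<inter> elements (inf I J) \<noteq> {}"
      by (auto simp: inf_ideal.rep_eq)
  qed (auto simp: inf_ideal.rep_eq)
  then show ?thesis
    unfolding stone_open_def by blast
qed

lemma stone_open_sup: "stone_open (sup I J) = stone_open I \<union> stone_open J"
proof -
  have "F \<inter> elements (sup I J) \<noteq> {} \<longleftrightarrow> F \<inter> elements I \<noteq> {} \<or> F \<inter> elements J \<noteq> {}"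
    if F: "is_prime_filter F" for F
  proof
    assume "F \<inter> elements (sup I J) \<noteq> {}"
    then obtain x u v where "x \<in> F" "u \<in> elements I" "v \<in> elements J" "x \<le> sup u v"
      by (auto simp: mem_sup_ideal)
    moreover from this have "sup u v \<in> F"
      using F unfolding is_prime_filter_def by blast
    ultimately show "F \<inter> elements I \<noteq> {} \<or> F \<inter> elements J \<noteq> {}"
      using prime_filter_sup_iff[OF F] by blast
  next
    assume "F \<inter> elements I \<noteq> {} \<or> F \<inter> elements J \<noteq> {}"
    moreover have "elements I \<subseteq> elements (sup I J)" "elements J \<subseteq> elements (sup I J)"
      unfolding less_eq_ideal.rep_eq[symmetric] by simp_all
    ultimately show "F \<inter> elements (sup I J) \<noteq> {}"
      by blast
  qed
  then show ?thesis
    unfolding stone_open_def by blast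
qed

text \<open>
  The interior of the complement of \<open>stone_open I\<close> is the largest open set disjoint from it, and
  open sets correspond to ideals; so it is \<open>stone_open (pcompl I)\<close>.
\<close>

lemma closure_of_stone_open:
  "stone_space closure_of (stone_open I) = topspace stone_space - stone_open (pcompl I)"
proof
  have "stone_open I \<inter> stone_open (pcompl I) = {}"
    unfolding stone_open_inf[symmetric] stone_open_eq_empty_iff
    using inf_pcompl_eq_bot[of I] by (simp add: inf.commute)
  moreover have "stone_open I \<subseteq> topspace stone_space"
    by (rule openin_subset[OF openin_stone_open])
  ultimately have "stone_open I \<subseteq> topspace stone_space - stone_open (pcompl I)"
    by blast
  then show "stone_space closure_of (stone_open I) \<subseteq> topspace stone_space - stone_open (pcompl I)"
    by (intro closure_of_minimal closedin_diff closedin_topspace openin_stone_open)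
next
  show "topspace stone_space - stone_open (pcompl I) \<subseteq> stone_space closure_of (stone_open I)"
  proof
    fix F
    assume F: "F \<in> topspace stone_space - stone_open (pcompl I)"
    have "\<exists>G. G \<in> stone_open I \<and> G \<in> U" if "F \<in> U" "openin stone_space U" for U
    proof (rule ccontr)
      assume no: "\<not> ?thesis"
      obtain J where J: "U = stone_open J"
        using stone_open_of_openin[OF \<open>openin stone_space U\<close>] .
      then have "stone_open (inf J I) = {}"
        using no by (auto simp: stone_open_inf)
      then have "J \<le> pcompl I"
        by (simp add: stone_open_eq_empty_iff le_pcompl_iff)
      then have "U \<subseteq> stone_open (pcompl I)"
        unfolding J stone_open_def less_eq_ideal.rep_eq by blast
      then show False
        using F \<open>F \<in> U\<close> by blast
    qed
    then show "F \<in> stone_space closure_of (stone_open I)"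
      using F by (auto simp: in_closure_of)
  qed
qed

text \<open>
  The closure of \<open>stone_open I\<close> is open iff \<open>pcompl I\<close> has a complement \<open>J\<close> among the ideals.
  Such a \<open>J\<close> is disjoint from \<open>pcompl I\<close>, hence contained in \<open>pcompl (pcompl I)\<close>, and the latter
  covers together with \<open>pcompl I\<close> as well.
\<close>

lemma extremally_disconnected_locale_iff_space:
  "extremally_disconnected_locale TYPE('a::{distrib_lattice,bounded_lattice} ideal) \<longleftrightarrow>
    extremally_disconnected_space (stone_space :: 'a set topology)"
proof
  assume ed: "extremally_disconnected_locale TYPE('a ideal)"
  show "extremally_disconnected_space (stone_space :: 'a set topology)"
    unfolding extremally_disconnected_space_def
  proof (intro allI impI)
    fix U :: "'a set set"
    assume "openin stone_space U"
    then obtain I where U: "U = stone_open I"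
      by (rule stone_open_of_openin)
    have "stone_open (pcompl I) \<union> stone_open (pcompl (pcompl I)) = topspace stone_space"
      unfolding stone_open_sup[symmetric] stone_open_eq_topspace_iff
      using ed by (simp add: extremally_disconnected_locale_def)
    moreover have "stone_open (pcompl I) \<inter> stone_open (pcompl (pcompl I)) = {}"
      unfolding stone_open_inf[symmetric] stone_open_eq_empty_iff
      using inf_pcompl_eq_bot[of "pcompl I"] by (simp add: inf.commute)
    ultimately have "stone_space closure_of U = stone_open (pcompl (pcompl I))"
      unfolding U closure_of_stone_open by blast
    then show "openin stone_space (stone_space closure_of U)"
      by (simp add: openin_stone_open)
  qed
next
  assume ed: "extremally_disconnected_space (stone_space :: 'a set topology)"
  show "extremally_disconnected_locale TYPE('a ideal)"
    unfolding extremally_disconnected_locale_def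
  proof
    fix I :: "'a ideal"
    have "openin stone_space (topspace stone_space - stone_open (pcompl I))"
      using ed openin_stone_open[of I] closure_of_stone_open[of I]
      unfolding extremally_disconnected_space_def by metis
    then obtain J where J: "topspace stone_space - stone_open (pcompl I) = stone_open J"
      by (rule stone_open_of_openin)
    have "stone_open (inf J (pcompl I)) = {}"
      unfolding stone_open_inf J[symmetric] by blast
    then have "J \<le> pcompl (pcompl I)"
      by (simp add: stone_open_eq_empty_iff le_pcompl_iff)
    moreover have "stone_open (sup (pcompl I) J) = topspace stone_space"
      unfolding stone_open_sup J[symmetric]
      using openin_subset[OF openin_stone_open[of "pcompl I"]] by blast
    then have "sup (pcompl I) J = top"
      by (simp only: stone_open_eq_topspace_iff)
    ultimately show "sup (pcompl I) (pcompl (pcompl I)) = top"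
      by (metis order_refl sup_mono top_unique)
  qed
qed

section \<open>The characterization theorem\<close>

theorem proposition7p9:
  shows
    \<comment> \<open>the two forms of (i)\<close>
    "(extremally_disconnected_locale TYPE('a::{distrib_lattice,bounded_lattice} ideal) \<longleftrightarrow>
        extremally_disconnected_space (stone_space :: 'a set topology))
     \<and>
     \<comment> \<open>(i) iff (ii), with the descriptions of the negations\<close>
     (\<forall>(I :: 'a ideal) a. a \<in> elements (pcompl I) \<longleftrightarrow>
        (\<forall>b. b \<noteq> bot \<longrightarrow> b \<le> a \<longrightarrow> b \<notin> elements I))
     \<and>
     (\<forall>(I :: 'a ideal) a. a \<in> elements (pcompl (pcompl I)) \<longleftrightarrow>
        (\<forall>b. b \<noteq> bot \<longrightarrow> b \<le> a \<longrightarrow> (\<exists>c\<in>elements I. c \<noteq> bot \<and> c \<le> b)))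
     \<and>
     (extremally_disconnected_locale TYPE('a ideal) \<longleftrightarrow>
        (\<forall>I :: 'a ideal. \<exists>(K :: nat set) (a :: nat \<Rightarrow> 'a).
           finite K \<and> finite_join a K = top \<and>
           (\<forall>k\<in>K. a k \<in> elements (pcompl I) \<or> a k \<in> elements (pcompl (pcompl I)))))
     \<and>
     \<comment> \<open>(i) iff (iii)\<close>
     (extremally_disconnected_locale TYPE('a ideal) \<longleftrightarrow>
        (\<forall>A :: 'a set. bot \<notin> A \<longrightarrow>
           (\<exists>(J :: nat set) (b :: nat \<Rightarrow> 'a).
              finite J \<and> (\<forall>j\<in>J. b j \<noteq> bot) \<and> finite_join b J = top \<and>
              (\<forall>j\<in>J. (\<forall>a\<in>A. inf (b j) a = bot) \<or>
                 (\<forall>x. x \<noteq> bot \<longrightarrow> x \<le> b j \<longrightarrow> (\<exists>a\<in>A. inf x a \<noteq> bot))))))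
     \<and>
     \<comment> \<open>(i) iff (iv)\<close>
     (extremally_disconnected_locale TYPE('a ideal) \<longleftrightarrow>
        (\<forall>I :: 'a ideal.
           (\<forall>a. (\<forall>b. b \<noteq> bot \<longrightarrow> b \<le> a \<longrightarrow> (\<exists>c\<in>elements I. c \<noteq> bot \<and> c \<le> b)) \<longrightarrow>
              a \<in> elements I) \<longrightarrow>
           (\<exists>x. is_complemented x \<and> elements I = {d. d \<le> x})))
     \<and>
     \<comment> \<open>the isomorphism that holds in this case\<close>
     (extremally_disconnected_locale TYPE('a ideal) \<longrightarrow>
        (\<exists>f :: 'a complemented \<Rightarrow> 'a ideal regular_elt.
           lattice_isomorphism f \<and>
           (\<forall>x. regular_val (f x) = principal_ideal (complemented_val x))))"
proof (intro conjI allI impI)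
  show "extremally_disconnected_locale TYPE('a ideal) \<longleftrightarrow>
      extremally_disconnected_space (stone_space :: 'a set topology)"
    by (rule extremally_disconnected_locale_iff_space)
next
  fix I :: "'a ideal" and a :: 'a
  show "a \<in> elements (pcompl I) \<longleftrightarrow> (\<forall>b. b \<noteq> bot \<longrightarrow> b \<le> a \<longrightarrow> b \<notin> elements I)"
    by (rule mem_pcompl_ideal)
  show "a \<in> elements (pcompl (pcompl I)) \<longleftrightarrow>
      (\<forall>b. b \<noteq> bot \<longrightarrow> b \<le> a \<longrightarrow> (\<exists>c\<in>elements I. c \<noteq> bot \<and> c \<le> b))"
    by (rule mem_pcompl_pcompl_ideal)
next
  show "extremally_disconnected_locale TYPE('a ideal) \<longleftrightarrow>
      (\<forall>I :: 'a ideal.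
         (\<forall>a. (\<forall>b. b \<noteq> bot \<longrightarrow> b \<le> a \<longrightarrow> (\<exists>c\<in>elements I. c \<noteq> bot \<and> c \<le> b)) \<longrightarrow>
            a \<in> elements I) \<longrightarrow>
         (\<exists>x. is_complemented x \<and> elements I = {d. d \<le> x}))"
    unfolding extremally_disconnected_iff_regular_principal regular_ideal_iff
    by (simp add: elements_inject[symmetric] principal_ideal.rep_eq)
qed (rule extremally_disconnected_iff_ideal_covers extremally_disconnected_iff_family_covers
  complemented_isomorphic_regular_ideals; assumption?)+

end
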